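(* Let $k$ be a positive integer and let $\lambda$ be a nonempty balanced partition with $r$ rows (nonzero parts) and $c$ columns (i.e. $\lambda_1=c$). Then $$|\mathrm{BSSYT}(\lambda,k)|=\frac{krc}{r+c}\,|\mathrm{SYT}(\lambda,k)|.$$
   Context: A partition $\lambda=(\lambda_1\ge\lambda_2\ge\cdots\ge\lambda_r>0)$ is identified with its Young diagram (left-justified rows, $\lambda_i$ squares in row $i$, rows numbered from top). A set-valued semistandard Young tableau of shape $\lambda$ assigns a nonempty finite set of positive integers to each square such that for horizontally adjacent squares with sets $A$ (left) and $B$ (right) we have $\max A\le\min B$, and for vertically adjacent squares with $A$ above $B$ we have $\max A<\min B$. It is barely set-valued if exactly one square receives a set of size two and all other squares receive a single integer. $\mathrm{BSSYT}(\lambda,k)$ denotes the set of barely set-valued semistandard Young tableaux of shape $\lambda$ in which every integer in row $i$ is at most $k+i$; $\mathrm{SYT}(\lambda,k)$ denotes the set of ordinary semistandard Young tableaux (each square one positive integer, rows weakly increasing, columns strictly increasing) of shape $\lambda$ with every entry in row $i$ at most $k+i$. Balanced shape: draw the diagram of $\lambda$ in the plane with its bottom-left corner at $(0,0)$ and top-right corner at $(c,r)$, so row $i$ occupies $[0,\lambda_i]\times[r-i,r-i+1]$. An outward corner of $\lambda$ is a north step immediately followed by an east step on the southeast boundary of $\lambda$; its turning points are the points $(\lambda_{i+1},r-i)$ for those $1\le i\le r-1$ with $\lambda_i>\lambda_{i+1}$. $\lambda$ is balanced if every such turning point lies on the segment from $(0,0)$ to $(c,r)$, i.e. $r\lambda_{i+1}=c(r-i)$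 whenever $1\le i\le r-1$ and $\lambda_i>\lambda_{i+1}$. *)

theory Defs
  imports "HOL-Analysis.Analysis"
begin

definition is_partition :: "nat list \<Rightarrow> bool" where
  "is_partition lam \<longleftrightarrow> sorted_wrt (\<ge>) lam \<and> (\<forall>x\<in>set lam. 0 < x)"

text \<open>Parts, rows and columns are numbered from 1; \<open>part lam i\<close> is only meaningful for
  \<open>1 \<le> i \<le> length lam\<close>. A cell is a pair (row, column).\<close>

definition part :: "nat list \<Rightarrow> nat \<Rightarrow> nat" where
  "part lam i = lam ! (i - 1)"

definition diagram :: "nat list \<Rightarrow> (nat \<times> nat) set" where
  "diagram lam = {(i, j). 1 \<le> i \<and> i \<le> length lam \<and> 1 \<le> j \<and> j \<le> part lam i}"

text \<open>A filling is an extensional function on the diagram, so that distinct fillings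
  are distinct functions and fillings can be counted with \<open>card\<close>.\<close>

definition ssyt :: "nat list \<Rightarrow> (nat \<times> nat \<Rightarrow> nat) set" where
  "ssyt lam = {T \<in> diagram lam \<rightarrow>\<^sub>E {0<..}.
     (\<forall>i j. (i, j) \<in> diagram lam \<and> (i, j + 1) \<in> diagram lam \<longrightarrow> T (i, j) \<le> T (i, j + 1)) \<and>
     (\<forall>i j. (i, j) \<in> diagram lam \<and> (i + 1, j) \<in> diagram lam \<longrightarrow> T (i, j) < T (i + 1, j))}"

definition set_valued_ssyt :: "nat list \<Rightarrow> (nat \<times> nat \<Rightarrow> nat set) set" where
  "set_valued_ssyt lam = {T \<in> diagram lam \<rightarrow>\<^sub>E {A. finite A \<and> A \<noteq> {} \<and> A \<subseteq> {0<..}}.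
     (\<forall>i j. (i, j) \<in> diagram lam \<and> (i, j + 1) \<in> diagram lam \<longrightarrow>
        Max (T (i, j)) \<le> Min (T (i, j + 1))) \<and>
     (\<forall>i j. (i, j) \<in> diagram lam \<and> (i + 1, j) \<in> diagram lam \<longrightarrow>
        Max (T (i, j)) < Min (T (i + 1, j)))}"

definition barely_set_valued :: "nat list \<Rightarrow> (nat \<times> nat \<Rightarrow> nat set) \<Rightarrow> bool" where
  "barely_set_valued lam T \<longleftrightarrow>
     (\<exists>s\<in>diagram lam. card (T s) = 2 \<and> (\<forall>t\<in>diagram lam - {s}. card (T t) = 1))"

definition SYT :: "nat list \<Rightarrow> nat \<Rightarrow> (nat \<times> nat \<Rightarrow> nat) set" where
  "SYT lam k = {T \<in> ssyt lam. \<forall>(i, j)\<in>diagram lam. T (i, j) \<le> k + i}"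

definition BSSYT :: "nat list \<Rightarrow> nat \<Rightarrow> (nat \<times> nat \<Rightarrow> nat set) set" where
  "BSSYT lam k = {T \<in> set_valued_ssyt lam. barely_set_valued lam T \<and>
     (\<forall>(i, j)\<in>diagram lam. \<forall>x\<in>T (i, j). x \<le> k + i)}"

text \<open>The diagram is drawn in the plane with bottom-left corner \<open>(0, 0)\<close>, row \<open>i\<close> occupying
  \<open>[0, part lam i] \<times> [r - i, r - i + 1]\<close> where \<open>r = length lam\<close>. A turning point is where a
  north step along the right end of row \<open>i + 1\<close> meets an east step along the bottom of
  row \<open>i\<close>.\<close>

definition turning_points :: "nat list \<Rightarrow> (real \<times> real) set" where
  "turning_points lam = {(real (part lam (i + 1)), real (length lam) - real i) | i.
     1 \<le> i \<and> i + 1 \<le> length lam \<and> part lam i > part lam (i + 1)}"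

definition balanced :: "nat list \<Rightarrow> bool" where
  "balanced lam \<longleftrightarrow>
     turning_points lam \<subseteq> closed_segment (0, 0) (real (part lam 1), real (length lam))"

lemma balanced_iff:
  "balanced lam \<longleftrightarrow> (\<forall>i. 1 \<le> i \<and> i + 1 \<le> length lam \<and> part lam i > part lam (i + 1) \<longrightarrow>
     length lam * part lam (i + 1) = part lam 1 * (length lam - i))"
proof -
  have *: "(real a, real r - real i) \<in> closed_segment (0, 0) (real c, real r)
      \<longleftrightarrow> r * a = c * (r - i)" if "i + 1 \<le> r" for a c r i :: nat
  proof
    assume "(real a, real r - real i) \<in> closed_segment (0, 0) (real c, real r)"
    then obtain u where u: "real a = u * real c" "real r - real i = u * real r"
      unfolding in_segment by auto
    have "real r * real a = real c * (real r - real i)"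
      unfolding u by simp
    then have "real (r * a) = real (c * (r - i))"
      using that by (simp add: of_nat_diff)
    then show "r * a = c * (r - i)"
      by (simp only: of_nat_eq_iff)
  next
    assume "r * a = c * (r - i)"
    then have "real (r * a) = real (c * (r - i))"
      by (simp only:)
    then have eq: "real r * real a = real c * (real r - real i)"
      using that by (simp add: of_nat_diff)
    have r: "real r > 0" using that by simp
    define u where "u = (real r - real i) / real r"
    have "0 \<le> u" "u \<le> 1" "real r - real i = u * real r"
      using r that by (simp_all add: u_def)
    moreover have "real a = u * real c"
      using r eq by (simp add: u_def nonzero_eq_divide_eq mult.commute)
    ultimately show "(real a, real r - real i) \<in> closed_segment (0, 0) (real c, real r)"
      unfolding in_segment by (intro exI[of _ u] conjI) simp_all
  qed
  have "balanced lam \<longleftrightarrow> (\<forall>i. 1 \<le> i \<and> i + 1 \<le> length lam \<and> part lam i > part lam (i + 1) \<longrightarrow>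
     (real (part lam (i + 1)), real (length lam) - real i)
       \<in> closed_segment (0, 0) (real (part lam 1), real (length lam)))"
    unfolding balanced_def turning_points_def by blast
  with * show ?thesis by meson
qed

lemma finite_diagram: "finite (diagram lam)"
proof -
  have "diagram lam = (SIGMA i:{1..length lam}. {1..part lam i})"
    by (auto simp: diagram_def)
  then show ?thesis by simp
qed

lemma finite_SYT: "finite (SYT lam k)"
proof (rule finite_subset)
  show "SYT lam k \<subseteq> diagram lam \<rightarrow>\<^sub>E {..k + length lam}"
  proof
    fix T assume T: "T \<in> SYT lam k"
    have "T s \<le> k + length lam" if s: "s \<in> diagram lam" for s
    proof -
      have "T s \<le> k + fst s" using T s by (auto simp: SYT_def split_beta)
      moreover have "fst s \<le> length lam" using s by (auto simp: diagram_def)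
      ultimately show ?thesis by linarith
    qed
    with T show "T \<in> diagram lam \<rightarrow>\<^sub>E {..k + length lam}"
      by (simp add: SYT_def ssyt_def PiE_iff)
  qed
qed (simp add: finite_PiE finite_diagram)

lemma finite_BSSYT: "finite (BSSYT lam k)"
proof (rule finite_subset)
  show "BSSYT lam k \<subseteq> diagram lam \<rightarrow>\<^sub>E Pow {..k + length lam}"
  proof
    fix T assume T: "T \<in> BSSYT lam k"
    have "x \<le> k + length lam" if s: "s \<in> diagram lam" and x: "x \<in> T s" for s x
    proof -
      have "x \<le> k + fst s" using T s x by (auto simp: BSSYT_def split_beta)
      moreover have "fst s \<le> length lam" using s by (auto simp: diagram_def)
      ultimately show ?thesis by linarith
    qed
    with T show "T \<in> diagram lam \<rightarrow>\<^sub>E Pow {..k + length lam}"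
      by (simp add: BSSYT_def set_valued_ssyt_def PiE_iff subset_iff)
  qed
qed (simp add: finite_PiE finite_diagram)

end

theory Submission
  imports Defs
begin

text \<open>Let \<open>p s\<close> be the number of tableaux in \<open>BSSYT lam k\<close> whose two-element cell is \<open>s\<close>. Dropping the
  smaller or the larger element of that cell shows that \<open>p s\<close> is the sum, over all \<open>T\<close> in \<open>SYT lam k\<close>,
  of the number of values below, respectively above, \<open>T s\<close> that may be added to the cell.
  In terms of \<open>t (i, j) = T (i, j) - i\<close> these two numbers are a difference to a maximum of the
  upper and left neighbours and a difference to a minimum of the lower and right ones. Attach the first
  to the top-left vertex of \<open>s\<close> and the second, with a minus sign, to the bottom-right one:
  at every vertex the maximum and the minimum are then over the same pair of cells, so they add up to
  the sum of the pair, and what remains is a mixed second difference of \<open>t\<close>. Summed against the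
  affine weight \<open>r b + c a - r c\<close> it telescopes to \<open>- k r c\<close>; the outward corners, where cells outside
  the diagram would contribute, have weight \<open>0\<close> because the shape is balanced. Between the two vertices
  of \<open>s\<close> the weight grows by \<open>r + c\<close>, so summing over all \<open>T\<close> gives that \<open>(r + c)\<close> times the sum
  of \<open>p\<close> is \<open>k r c\<close> times the number of \<open>T\<close>.\<close>

section \<open>Diagrams and tableaux cell by cell\<close>

lemma part_Suc_le:
  assumes "is_partition lam" "1 \<le> i" "i + 1 \<le> length lam"
  shows "part lam (i + 1) \<le> part lam i"
  using assms by (auto simp: is_partition_def part_def sorted_wrt_iff_nth_less)

lemma part_pos:
  assumes "is_partition lam" "1 \<le> i" "i \<le> length lam"
  shows "0 < part lam i"
  using assms by (auto simp: is_partition_def part_def)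

lemma part_le_first:
  assumes "is_partition lam" "1 \<le> i" "i \<le> length lam"
  shows "part lam i \<le> part lam 1"
  using assms by (cases "i = 1") (auto simp: is_partition_def part_def sorted_wrt_iff_nth_less)

lemma diagram_left: "(i, j + 1) \<in> diagram lam \<Longrightarrow> 1 \<le> j \<Longrightarrow> (i, j) \<in> diagram lam"
  by (auto simp: diagram_def)

lemma diagram_up:
  assumes "is_partition lam" "(i + 1, j) \<in> diagram lam" "1 \<le> i"
  shows "(i, j) \<in> diagram lam"
  using assms part_Suc_le[of lam i] by (auto simp: diagram_def)

lemma SYT_iff:
  "T \<in> SYT lam k \<longleftrightarrow> T \<in> extensional (diagram lam) \<and>
     (\<forall>i j. (i, j) \<in> diagram lam \<longrightarrow> 0 < T (i, j) \<and> T (i, j) \<le> k + i) \<and>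
     (\<forall>i j. (i, j) \<in> diagram lam \<and> (i, j + 1) \<in> diagram lam \<longrightarrow> T (i, j) \<le> T (i, j + 1)) \<and>
     (\<forall>i j. (i, j) \<in> diagram lam \<and> (i + 1, j) \<in> diagram lam \<longrightarrow> T (i, j) < T (i + 1, j))"
  by (auto simp: SYT_def ssyt_def PiE_iff)

lemma BSSYT_iff:
  "U \<in> BSSYT lam k \<longleftrightarrow> U \<in> extensional (diagram lam) \<and>
     (\<forall>i j. (i, j) \<in> diagram lam \<longrightarrow>
        finite (U (i, j)) \<and> U (i, j) \<noteq> {} \<and> U (i, j) \<subseteq> {0<..k + i}) \<and>
     (\<forall>i j. (i, j) \<in> diagram lam \<and> (i, j + 1) \<in> diagram lam \<longrightarrow>
        Max (U (i, j)) \<le> Min (U (i, j + 1))) \<and>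
     (\<forall>i j. (i, j) \<in> diagram lam \<and> (i + 1, j) \<in> diagram lam \<longrightarrow>
        Max (U (i, j)) < Min (U (i + 1, j))) \<and>
     barely_set_valued lam U"
  by (auto simp: BSSYT_def set_valued_ssyt_def PiE_iff subset_iff)

text \<open>Positive entries and strict columns raise the lower bound by one per row. Hence
  \<open>T (i, j) - i\<close> is never negative, which makes 0 a lower bound for
  \<open>shifted\<close>.\<close>

lemma SYT_ge_row:
  assumes "is_partition lam" "T \<in> SYT lam k" "(i, j) \<in> diagram lam"
  shows "i \<le> T (i, j)"
  using assms(3)
proof (induction i)
  case (Suc i)
  show ?case
  proof (cases "i = 0")
    case True
    with Suc.prems assms(2) show ?thesis by (auto simp: SYT_iff Suc_le_eq)
  next
    case False
    then have "(i, j) \<in> diagram lam"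
      using diagram_up[OF assms(1), of i j] Suc.prems by simp
    moreover from this have "T (i, j) < T (Suc i, j)"
      using assms(2) Suc.prems by (auto simp: SYT_iff)
    ultimately show ?thesis using Suc.IH by linarith
  qed
qed simp

section \<open>Tableaux with a prescribed two-element cell\<close>

definition add_value :: "nat list \<Rightarrow> (nat \<times> nat \<Rightarrow> nat) \<Rightarrow> nat \<times> nat \<Rightarrow> nat \<Rightarrow> nat \<times> nat \<Rightarrow> nat set"
  where "add_value lam T s x = (\<lambda>t\<in>diagram lam. if t = s then {x, T s} else {T t})"

lemma barely_set_valued_add_value:
  assumes "s \<in> diagram lam" "x \<noteq> T s"
  shows "barely_set_valued lam (add_value lam T s x)"
  unfolding barely_set_valued_def
  using assms by (intro bexI[of _ s]) (auto simp: add_value_def)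

text \<open>Each selected entry lies between \<open>Min\<close> and \<open>Max\<close> of its cell,
  and the set-valued conditions compare a \<open>Max\<close> with the next \<open>Min\<close>.
  Leaving \<open>sel\<close> open treats removal of the smaller and of the larger element at
  once.\<close>

lemma selection_in_SYT:
  assumes U: "U \<in> BSSYT lam k" and sel: "sel = Max \<or> sel = Min"
  shows "(\<lambda>t\<in>diagram lam. sel (U t)) \<in> SYT lam k"
proof -
  have *: "finite (U (i, j))" "U (i, j) \<noteq> {}" "U (i, j) \<subseteq> {0<..k + i}"
    if "(i, j) \<in> diagram lam" for i j
    using U that by (auto simp: BSSYT_iff)
  have mem: "sel (U (i, j)) \<in> U (i, j)" if "(i, j) \<in> diagram lam" for i j
    using sel Max_in[OF *(1,2)[OF that]] Min_in[OF *(1,2)[OF that]] by metis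
  have le: "sel (U (i, j)) \<le> Max (U (i, j))" and ge: "Min (U (i, j)) \<le> sel (U (i, j))"
    if "(i, j) \<in> diagram lam" for i j
    using *[OF that] mem[OF that] by auto
  have row: "sel (U (i, j)) \<le> sel (U (i, j + 1))"
    if "(i, j) \<in> diagram lam" "(i, j + 1) \<in> diagram lam" for i j
  proof -
    have "Max (U (i, j)) \<le> Min (U (i, j + 1))" using U that unfolding BSSYT_iff by blast
    with le[OF that(1)] ge[OF that(2)] show ?thesis by linarith
  qed
  have col: "sel (U (i, j)) < sel (U (i + 1, j))"
    if "(i, j) \<in> diagram lam" "(i + 1, j) \<in> diagram lam" for i j
  proof -
    have "Max (U (i, j)) < Min (U (i + 1, j))" using U that unfolding BSSYT_iff by blast
    with le[OF that(1)] ge[OF that(2)] show ?thesis by linarith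
  qed
  have "0 < sel (U (i, j)) \<and> sel (U (i, j)) \<le> k + i" if "(i, j) \<in> diagram lam" for i j
    using *(3)[OF that] mem[OF that] by auto
  with row col show ?thesis by (auto simp: SYT_iff)
qed

text \<open>\<open>U\<close> corresponds to the pair of \<open>T\<close>, which keeps
  \<open>sel (U s)\<close> at \<open>s\<close>, and the removed element \<open>x\<close>. The
  condition \<open>sel {x, T s} = T s\<close> makes this pair recoverable from
  \<open>U\<close>.\<close>

lemma card_double_cell:
  assumes s: "s \<in> diagram lam" and sel: "sel = Max \<or> sel = Min"
  shows "card {U \<in> BSSYT lam k. card (U s) = 2} =
    (\<Sum>T\<in>SYT lam k. card {x. x \<noteq> T s \<and> sel {x, T s} = T s \<and> add_value lam T s x \<in> BSSYT lam k})"
    (is "card ?B = (\<Sum>T\<in>_. card (?X T))")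
proof -
  let ?f = "\<lambda>(T, x). add_value lam T s x"
  have add_s: "add_value lam T s x s = {x, T s}" for T x
    using s by (simp add: add_value_def)
  have "inj_on ?f (Sigma (SYT lam k) ?X)"
  proof (rule inj_onI, clarify)
    fix T x T' x'
    assume T: "T \<in> SYT lam k" "T' \<in> SYT lam k"
      and eq: "add_value lam T s x = add_value lam T' s x'"
      and x: "x \<noteq> T s" "sel {x, T s} = T s" "x' \<noteq> T' s" "sel {x', T' s} = T' s"
    have pair: "{x, T s} = {x', T' s}" using eq add_s by metis
    with x have Ts: "T s = T' s" by metis
    have "T t = T' t" if "t \<in> diagram lam" for t
      using fun_cong[OF eq, of t] Ts that by (auto simp: add_value_def split: if_splits)
    moreover have "T t = T' t" if "t \<notin> diagram lam" for t
      using T that extensional_arb[of _ "diagram lam" t] by (metis SYT_iff)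
    ultimately have "T = T'" by blast
    moreover from pair Ts x have "x = x'" by (auto simp: doubleton_eq_iff)
    ultimately show "T = T' \<and> x = x'" by blast
  qed
  moreover have "?f ` Sigma (SYT lam k) ?X = ?B"
  proof (intro equalityI subsetI)
    fix U assume "U \<in> ?f ` Sigma (SYT lam k) ?X"
    then show "U \<in> ?B" by (auto simp: add_s card_insert_if)
  next
    fix U assume "U \<in> ?B"
    then have U: "U \<in> BSSYT lam k" and two: "card (U s) = 2" by auto
    define T where "T = (\<lambda>t\<in>diagram lam. sel (U t))"
    have T: "T \<in> SYT lam k" unfolding T_def by (rule selection_in_SYT[OF U sel])
    have Ts: "T s = sel (U s)" using s by (simp add: T_def)
    from two obtain a b where ab: "U s = {a, b}" "a \<noteq> b" by (auto simp: card_2_iff)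
    have "sel (U s) \<in> {a, b}"
      unfolding ab(1) using sel Max_in[of "{a, b}"] Min_in[of "{a, b}"] by fastforce
    with Ts ab(1) have "T s = a \<or> T s = b" by simp
    with ab obtain x where x: "U s = {x, T s}" "x \<noteq> T s" by (metis insert_commute)
    \<comment> \<open>The cell witnessing \<open>barely_set_valued\<close> must be \<open>s\<close>,
      as \<open>U s\<close> has two elements.\<close>
    have single: "U t = {T t}" if "t \<in> diagram lam" "t \<noteq> s" for t
    proof -
      from U obtain s' where "s' \<in> diagram lam" "card (U s') = 2"
        "\<forall>t\<in>diagram lam - {s'}. card (U t) = 1"
        by (auto simp: BSSYT_iff barely_set_valued_def)
      with two s have "\<forall>t\<in>diagram lam - {s}. card (U t) = 1" by (cases "s = s'") auto
      with that have "card (U t) = 1" by blast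
      then obtain y where "U t = {y}" by (auto simp: card_1_singleton_iff)
      with that sel show ?thesis by (auto simp: T_def)
    qed
    have "U t = add_value lam T s x t" for t
    proof (cases "t \<in> diagram lam")
      case False
      moreover have "U \<in> extensional (diagram lam)" using U unfolding BSSYT_iff by blast
      ultimately have "U t = undefined" by (intro extensional_arb)
      with False show ?thesis by (simp add: add_value_def)
    next
      case True
      with x single show ?thesis by (auto simp: add_value_def)
    qed
    then have "U = add_value lam T s x" by blast
    moreover have "x \<in> ?X T" using calculation U x Ts by auto
    ultimately show "U \<in> ?f ` Sigma (SYT lam k) ?X" using T by force
  qed
  ultimately have "bij_betw ?f (Sigma (SYT lam k) ?X) ?B" by (simp add: bij_betw_def)
  then have "card ?B = card (Sigma (SYT lam k) ?X)" by (simp add: bij_betw_same_card)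
  also have "\<dots> = (\<Sum>T\<in>SYT lam k. card (?X T))"
  proof (rule card_SigmaI)
    show "\<forall>T\<in>SYT lam k. finite (?X T)"
    proof
      fix T assume "T \<in> SYT lam k"
      have "?X T \<subseteq> {..k + fst s}"
        using s by (cases s) (auto simp: BSSYT_iff add_value_def)
      then show "finite (?X T)" by (rule finite_subset) simp
    qed
  qed (rule finite_SYT)
  finally show ?thesis .
qed

text \<open>Subtracting the row index turns strict columns into weak ones and the flag \<open>k + i\<close> into the
  uniform bound \<open>k\<close>; the values off the diagram are the ones implied by these bounds.\<close>

definition shifted :: "nat list \<Rightarrow> nat \<Rightarrow> (nat \<times> nat \<Rightarrow> nat) \<Rightarrow> nat \<Rightarrow> nat \<Rightarrow> int" where
  "shifted lam k T a b = (if a = 0 \<or> b = 0 then 0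
     else if (a, b) \<in> diagram lam then int (T (a, b)) - int a else int k)"

lemma shifted_bounds:
  assumes "is_partition lam" "T \<in> SYT lam k"
  shows "0 \<le> shifted lam k T a b" "shifted lam k T a b \<le> int k"
proof -
  have "int (T (a, b)) \<le> int k + int a" if "(a, b) \<in> diagram lam"
    using assms(2) that by (auto simp: SYT_iff simp flip: of_nat_add)
  moreover have "int a \<le> int (T (a, b))" if "(a, b) \<in> diagram lam"
    using SYT_ge_row[OF assms that] by simp
  ultimately show "0 \<le> shifted lam k T a b" "shifted lam k T a b \<le> int k"
    by (auto simp: shifted_def)
qed

text \<open>Across the edge of the diagram this holds because 0 and \<open>k\<close> bound all
  values: the smaller side is 0 on an axis, or the larger side is \<open>k\<close> off the
  diagram.\<close>

lemma shifted_mono: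
  assumes "is_partition lam" "T \<in> SYT lam k"
  shows "shifted lam k T a b \<le> shifted lam k T a (b + 1)"
    and "shifted lam k T a b \<le> shifted lam k T (a + 1) b"
proof -
  note bounds = shifted_bounds[OF assms]
  show "shifted lam k T a b \<le> shifted lam k T a (b + 1)"
  proof (cases "a \<noteq> 0 \<and> b \<noteq> 0 \<and> (a, b + 1) \<in> diagram lam")
    case True
    moreover from this have "(a, b) \<in> diagram lam" using diagram_left[of a b lam] by simp
    moreover from calculation have "T (a, b) \<le> T (a, b + 1)" using assms(2) by (auto simp: SYT_iff)
    ultimately show ?thesis by (simp add: shifted_def)
  next
    case False
    then show ?thesis using bounds[of a b] bounds[of a "b + 1"] by (auto simp: shifted_def)
  qed
  show "shifted lam k T a b \<le> shifted lam k T (a + 1) b"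
  proof (cases "a \<noteq> 0 \<and> b \<noteq> 0 \<and> (a + 1, b) \<in> diagram lam")
    case True
    moreover from this have "(a, b) \<in> diagram lam" using diagram_up[OF assms(1), of a b] by simp
    moreover from calculation have "T (a, b) < T (a + 1, b)" using assms(2) by (auto simp: SYT_iff)
    ultimately show ?thesis by (simp add: shifted_def)
  next
    case False
    then show ?thesis using bounds[of a b] bounds[of "a + 1" b] by (auto simp: shifted_def)
  qed
qed

section \<open>Counting the values that may be added to a cell\<close>

lemma add_value_below_iff:
  assumes lam: "is_partition lam" and T: "T \<in> SYT lam k"
    and s: "(a + 1, b + 1) \<in> diagram lam" and x: "x < T (a + 1, b + 1)"
  shows "add_value lam T (a + 1, b + 1) x \<in> BSSYT lam k \<longleftrightarrow>
    max (shifted lam k T a (b + 1)) (shifted lam k T (a + 1) b) + int (a + 1) \<le> int x"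
    (is "?L \<longleftrightarrow> ?R")
proof -
  let ?U = "add_value lam T (a + 1, b + 1) x"
  note TD = T[unfolded SYT_iff]
  have left: "b \<noteq> 0 \<Longrightarrow> (a + 1, b) \<in> diagram lam" using s by (rule diagram_left) auto
  have up: "a \<noteq> 0 \<Longrightarrow> (a, b + 1) \<in> diagram lam" using s by (rule diagram_up[OF lam]) auto
  \<comment> \<open>The offset \<open>a + 1\<close> undoes the shift in this row; for the upper
    neighbour, shifted by \<open>a\<close> only, it encodes strictness. As both shifted values are
    nonnegative, \<open>a + 1 \<le> x\<close> comes for free.\<close>
  have R: "?R \<longleftrightarrow> a + 1 \<le> x \<and> (b \<noteq> 0 \<longrightarrow> T (a + 1, b) \<le> x) \<and> (a \<noteq> 0 \<longrightarrow> T (a, b + 1) < x)"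
    using left up SYT_ge_row[OF lam T left] SYT_ge_row[OF lam T up]
    by (auto simp: shifted_def)
  have Us: "?U (a + 1, b + 1) = {x, T (a + 1, b + 1)}" using s by (simp add: add_value_def)
  have Ut: "?U t = {T t}" if "t \<in> diagram lam" "t \<noteq> (a + 1, b + 1)" for t
    using that by (simp add: add_value_def)
  \<comment> \<open>The new element is the smaller one, so only \<open>Min\<close> at this cell
    changes, and only the conditions towards the left and upper neighbours are new.\<close>
  have MinU: "Min (?U t) = (if t = (a + 1, b + 1) then x else T t)"
    and MaxU: "Max (?U t) = T t" if "t \<in> diagram lam" for t
    using that x Us Ut[OF that] by (cases "t = (a + 1, b + 1)"; simp)+
  show ?thesis unfolding R
  proof
    assume L: ?L
    have 1: "T (a + 1, b) \<le> x" if "b \<noteq> 0"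
    proof -
      have "Max (?U (a + 1, b)) \<le> Min (?U (a + 1, b + 1))"
        using L left[OF that] s unfolding BSSYT_iff by blast
      then show ?thesis using MinU MaxU s left[OF that] by simp
    qed
    have 2: "T (a, b + 1) < x" if "a \<noteq> 0"
    proof -
      have "Max (?U (a, b + 1)) < Min (?U (a + 1, b + 1))"
        using L up[OF that] s unfolding BSSYT_iff by blast
      then show ?thesis using MinU MaxU s up[OF that] by simp
    qed
    have "?U (a + 1, b + 1) \<subseteq> {0<..k + (a + 1)}" using L s unfolding BSSYT_iff by blast
    then have "0 < x" using Us by auto
    \<comment> \<open>In the first row this is positivity; further down the upper entry is at least
      \<open>a\<close> and less than \<open>x\<close>.\<close>
    then have "a + 1 \<le> x" using 2 SYT_ge_row[OF lam T up] by (cases "a = 0") auto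
    with 1 2 show "a + 1 \<le> x \<and> (b \<noteq> 0 \<longrightarrow> T (a + 1, b) \<le> x) \<and> (a \<noteq> 0 \<longrightarrow> T (a, b + 1) < x)"
      by blast
  next
    assume R': "a + 1 \<le> x \<and> (b \<noteq> 0 \<longrightarrow> T (a + 1, b) \<le> x) \<and> (a \<noteq> 0 \<longrightarrow> T (a, b + 1) < x)"
    show ?L unfolding BSSYT_iff
    proof (intro conjI allI impI)
      show "?U \<in> extensional (diagram lam)" by (simp add: add_value_def)
      show "barely_set_valued lam ?U" using s x by (intro barely_set_valued_add_value) auto
    next
      fix i j assume ij: "(i, j) \<in> diagram lam"
      have "0 < T (i, j) \<and> T (i, j) \<le> k + i" using TD ij by blast
      then show "finite (?U (i, j))" "?U (i, j) \<noteq> {}" "?U (i, j) \<subseteq> {0<..k + i}"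
        using Us Ut[OF ij] R' x by (cases "(i, j) = (a + 1, b + 1)"; auto)+
    next
      fix i j assume ij: "(i, j) \<in> diagram lam \<and> (i, j + 1) \<in> diagram lam"
      then have "T (i, j) \<le> T (i, j + 1)" "1 \<le> j" using TD by (blast, auto simp: diagram_def)
      then show "Max (?U (i, j)) \<le> Min (?U (i, j + 1))" using MinU MaxU ij R' by auto
    next
      fix i j assume ij: "(i, j) \<in> diagram lam \<and> (i + 1, j) \<in> diagram lam"
      then have "T (i, j) < T (i + 1, j)" "1 \<le> i" using TD by (blast, auto simp: diagram_def)
      then show "Max (?U (i, j)) < Min (?U (i + 1, j))" using MinU MaxU ij R' by auto
    qed
  qed
qed

text \<open>Dually, only \<open>Max\<close> at the cell changes. A right or lower neighbour off the
  diagram has shifted value \<open>k\<close>, which is the flag for \<open>x\<close>; one inside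
  obeys its own flag, which again implies \<open>x \<le> k + a\<close>.\<close>

lemma add_value_above_iff:
  assumes T: "T \<in> SYT lam k"
    and s: "(a, b) \<in> diagram lam" and x: "T (a, b) < x"
  shows "add_value lam T (a, b) x \<in> BSSYT lam k \<longleftrightarrow>
    int x \<le> min (shifted lam k T a (b + 1)) (shifted lam k T (a + 1) b) + int a"
    (is "?L \<longleftrightarrow> ?R")
proof -
  let ?U = "add_value lam T (a, b) x"
  note TD = T[unfolded SYT_iff]
  have pos: "0 < a" "0 < b" using s by (auto simp: diagram_def)
  have "T (a, b + 1) \<le> k + a" if "(a, b + 1) \<in> diagram lam" using TD that by blast
  moreover have "T (a + 1, b) \<le> k + (a + 1)" if "(a + 1, b) \<in> diagram lam" using TD that by blast
  ultimately have R: "?R \<longleftrightarrow> x \<le> k + a \<and> ((a, b + 1) \<in> diagram lam \<longrightarrow> x \<le> T (a, b + 1)) \<and>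
      ((a + 1, b) \<in> diagram lam \<longrightarrow> x < T (a + 1, b))"
    using pos by (auto simp: shifted_def)
  have Us: "?U (a, b) = {x, T (a, b)}" using s by (simp add: add_value_def)
  have Ut: "?U t = {T t}" if "t \<in> diagram lam" "t \<noteq> (a, b)" for t
    using that by (simp add: add_value_def)
  have MaxU: "Max (?U t) = (if t = (a, b) then x else T t)"
    and MinU: "Min (?U t) = T t" if "t \<in> diagram lam" for t
    using that x Us Ut[OF that] by (cases "t = (a, b)"; simp)+
  show ?thesis unfolding R
  proof
    assume L: ?L
    have 1: "x \<le> T (a, b + 1)" if "(a, b + 1) \<in> diagram lam"
    proof -
      have "Max (?U (a, b)) \<le> Min (?U (a, b + 1))"
        using L that s unfolding BSSYT_iff by blast
      then show ?thesis using MinU MaxU s that by simp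
    qed
    have 2: "x < T (a + 1, b)" if "(a + 1, b) \<in> diagram lam"
    proof -
      have "Max (?U (a, b)) < Min (?U (a + 1, b))"
        using L that s unfolding BSSYT_iff by blast
      then show ?thesis using MinU MaxU s that by simp
    qed
    have "?U (a, b) \<subseteq> {0<..k + a}" using L s unfolding BSSYT_iff by blast
    then have "x \<le> k + a" using Us by auto
    with 1 2 show "x \<le> k + a \<and> ((a, b + 1) \<in> diagram lam \<longrightarrow> x \<le> T (a, b + 1)) \<and>
      ((a + 1, b) \<in> diagram lam \<longrightarrow> x < T (a + 1, b))"
      by blast
  next
    assume R': "x \<le> k + a \<and> ((a, b + 1) \<in> diagram lam \<longrightarrow> x \<le> T (a, b + 1)) \<and>
      ((a + 1, b) \<in> diagram lam \<longrightarrow> x < T (a + 1, b))"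
    show ?L unfolding BSSYT_iff
    proof (intro conjI allI impI)
      show "?U \<in> extensional (diagram lam)" by (simp add: add_value_def)
      show "barely_set_valued lam ?U" using s x by (intro barely_set_valued_add_value) auto
    next
      fix i j assume ij: "(i, j) \<in> diagram lam"
      have "0 < T (i, j) \<and> T (i, j) \<le> k + i" using TD ij by blast
      then show "finite (?U (i, j))" "?U (i, j) \<noteq> {}" "?U (i, j) \<subseteq> {0<..k + i}"
        using Us Ut[OF ij] R' x by (cases "(i, j) = (a, b)"; auto)+
    next
      fix i j assume ij: "(i, j) \<in> diagram lam \<and> (i, j + 1) \<in> diagram lam"
      then have "T (i, j) \<le> T (i, j + 1)" using TD by blast
      then show "Max (?U (i, j)) \<le> Min (?U (i, j + 1))" using MinU MaxU ij R' by auto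
    next
      fix i j assume ij: "(i, j) \<in> diagram lam \<and> (i + 1, j) \<in> diagram lam"
      then have "T (i, j) < T (i + 1, j)" using TD by blast
      then show "Max (?U (i, j)) < Min (?U (i + 1, j))" using MinU MaxU ij R' by auto
    qed
  qed
qed

text \<open>The index \<open>(a, b)\<close> names a vertex: the top-left one of the cell
  \<open>(a + 1, b + 1)\<close> here, the bottom-right one of the cell \<open>(a, b)\<close> in
  \<open>gap_above\<close>. With this indexing both formulas involve the same pair of
  neighbours.\<close>

definition gap_below :: "nat list \<Rightarrow> nat \<Rightarrow> (nat \<times> nat \<Rightarrow> nat) \<Rightarrow> nat \<Rightarrow> nat \<Rightarrow> int" where
  "gap_below lam k T a b = shifted lam k T (a + 1) (b + 1) -
     max (shifted lam k T a (b + 1)) (shifted lam k T (a + 1) b)"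

definition gap_above :: "nat list \<Rightarrow> nat \<Rightarrow> (nat \<times> nat \<Rightarrow> nat) \<Rightarrow> nat \<Rightarrow> nat \<Rightarrow> int" where
  "gap_above lam k T a b =
     min (shifted lam k T a (b + 1)) (shifted lam k T (a + 1) b) - shifted lam k T a b"

lemma card_double_cell_below:
  assumes lam: "is_partition lam" and s: "(a + 1, b + 1) \<in> diagram lam"
  shows "int (card {U \<in> BSSYT lam k. card (U (a + 1, b + 1)) = 2}) =
    (\<Sum>T\<in>SYT lam k. gap_below lam k T a b)"
proof -
  let ?s = "(a + 1, b + 1)"
  have "int (card {x. x \<noteq> T ?s \<and> Max {x, T ?s} = T ?s \<and> add_value lam T ?s x \<in> BSSYT lam k}) =
      gap_below lam k T a b" (is "int (card ?X) = _") if T: "T \<in> SYT lam k" for T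
  proof -
    define m where "m = max (shifted lam k T a (b + 1)) (shifted lam k T (a + 1) b)"
    \<comment> \<open>\<open>m0\<close> makes the later \<open>nat\<close> harmless, and
      \<open>m1\<close> keeps the size of the interval from being truncated at 0.\<close>
    have m0: "0 \<le> m" using shifted_bounds(1)[OF lam T] by (simp add: m_def le_max_iff_disj)
    have m1: "m \<le> shifted lam k T (a + 1) (b + 1)"
      unfolding m_def using shifted_mono[OF lam T] by simp
    have h: "shifted lam k T (a + 1) (b + 1) = int (T ?s) - int (a + 1)"
      using s by (simp add: shifted_def)
    have "?X = {x. x < T ?s \<and> add_value lam T ?s x \<in> BSSYT lam k}" by (auto simp: max_def)
    also have "\<dots> = {nat (m + int (a + 1))..<T ?s}"
      using add_value_below_iff[OF lam T s] m0 unfolding m_def by auto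
    finally show ?thesis using m0 m1 h unfolding gap_below_def m_def[symmetric] by simp
  qed
  then show ?thesis
    using card_double_cell[OF s, of Max k] by (simp cong: sum.cong)
qed

lemma card_double_cell_above:
  assumes lam: "is_partition lam" and s: "(a, b) \<in> diagram lam"
  shows "int (card {U \<in> BSSYT lam k. card (U (a, b)) = 2}) =
    (\<Sum>T\<in>SYT lam k. gap_above lam k T a b)"
proof -
  let ?s = "(a, b)"
  have "int (card {x. x \<noteq> T ?s \<and> Min {x, T ?s} = T ?s \<and> add_value lam T ?s x \<in> BSSYT lam k}) =
      gap_above lam k T a b" (is "int (card ?X) = _") if T: "T \<in> SYT lam k" for T
  proof -
    define m where "m = min (shifted lam k T a (b + 1)) (shifted lam k T (a + 1) b)"
    have m0: "0 \<le> m" using shifted_bounds(1)[OF lam T] by (simp add: m_def)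
    have m1: "shifted lam k T a b \<le> m"
      unfolding m_def using shifted_mono[OF lam T] by simp
    have h: "shifted lam k T a b = int (T ?s) - int a"
      using s by (auto simp: shifted_def diagram_def)
    have "?X = {x. T ?s < x \<and> add_value lam T ?s x \<in> BSSYT lam k}" by (auto simp: min_def)
    also have "\<dots> = {T ?s<..nat (m + int a)}"
      using add_value_above_iff[OF T s] m0 unfolding m_def by auto
    finally show ?thesis using m0 m1 h unfolding gap_above_def m_def[symmetric] by simp
  qed
  then show ?thesis
    using card_double_cell[OF s, of Min k] by (simp cong: sum.cong)
qed

lemma card_BSSYT_eq_sum:
  "card (BSSYT lam k) = (\<Sum>s\<in>diagram lam. card {U \<in> BSSYT lam k. card (U s) = 2})"
proof -
  have "BSSYT lam k = (\<Union>s\<in>diagram lam. {U \<in> BSSYT lam k. card (U s) = 2})"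
    by (auto simp: BSSYT_def barely_set_valued_def)
  also have "card \<dots> = (\<Sum>s\<in>diagram lam. card {U \<in> BSSYT lam k. card (U s) = 2})"
  proof (rule card_UN_disjoint)
    show "\<forall>s\<in>diagram lam. \<forall>t\<in>diagram lam. s \<noteq> t \<longrightarrow>
      {U \<in> BSSYT lam k. card (U s) = 2} \<inter> {U \<in> BSSYT lam k. card (U t) = 2} = {}"
    proof (intro ballI impI equals0I)
      fix s t U
      assume "s \<in> diagram lam" "t \<in> diagram lam" "s \<noteq> t"
        and U: "U \<in> {U \<in> BSSYT lam k. card (U s) = 2} \<inter> {U \<in> BSSYT lam k. card (U t) = 2}"
      moreover from U obtain s' where "\<forall>t\<in>diagram lam - {s'}. card (U t) = 1"
        by (auto simp: BSSYT_def barely_set_valued_def)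
      ultimately show False by (cases "s = s'") auto
    qed
  qed (use finite_BSSYT finite_diagram in auto)
  finally show ?thesis .
qed

section \<open>Weighted telescoping over the vertices of the bounding rectangle\<close>

lemma sum_weighted_mixed_difference:
  fixes h :: "nat \<Rightarrow> nat \<Rightarrow> int" and r c :: nat and k :: int
  assumes h0: "\<And>a. h a 0 = 0" "\<And>b. h 0 b = 0"
    and hk: "\<And>b. h (r + 1) (b + 1) = k" "\<And>a. h (a + 1) (c + 1) = k"
  shows "(\<Sum>a\<le>r. \<Sum>b\<le>c. (int r * int b + int c * int a - int r * int c) *
      (h (a + 1) (b + 1) + h a b - h a (b + 1) - h (a + 1) b)) = - (k * int r * int c)"
proof -
  let ?d = "\<lambda>a b. h (a + 1) (b + 1) + h a b - h a (b + 1) - h (a + 1) b"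
  have col: "(\<Sum>a\<le>r. ?d a b) = h (r + 1) (b + 1) - h (r + 1) b" for b
  proof -
    have "(\<Sum>a\<le>n. ?d a b) = h (n + 1) (b + 1) - h (n + 1) b" for n
      by (induction n) (simp_all add: h0)
    then show ?thesis .
  qed
  have row: "(\<Sum>b\<le>c. ?d a b) = h (a + 1) (c + 1) - h a (c + 1)" for a
  proof -
    have "(\<Sum>b\<le>n. ?d a b) = h (a + 1) (n + 1) - h a (n + 1)" for n
      by (induction n) (simp_all add: h0)
    then show ?thesis .
  qed
  have jump: "(\<Sum>a\<le>n. f a * (if a = 0 then k else 0)) = f 0 * k" for f :: "nat \<Rightarrow> int" and n
    by (induction n) simp_all
  \<comment> \<open>The difference is \<open>k - 0\<close> next to the axis and \<open>k - k\<close>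
    everywhere else.\<close>
  have colk: "h (r + 1) (b + 1) - h (r + 1) b = (if b = 0 then k else 0)" for b
    using hk(1)[of b] hk(1)[of "b - 1"] by (cases "b = 0") (auto simp: h0)
  have rowk: "h (a + 1) (c + 1) - h a (c + 1) = (if a = 0 then k else 0)" for a
    using hk(2)[of a] hk(2)[of "a - 1"] by (cases "a = 0") (auto simp: h0)
  \<comment> \<open>Each part of the weight depends on one index, so summing over the other
    telescopes. The constant joins the part in \<open>b\<close>, which leaves the factor
    \<open>- r c\<close> at \<open>b = 0\<close> and 0 at \<open>a = 0\<close>.\<close>
  have "(\<Sum>a\<le>r. \<Sum>b\<le>c. (int r * int b + int c * int a - int r * int c) * ?d a b) =
      (\<Sum>a\<le>r. \<Sum>b\<le>c. (int r * int b - int r * int c) * ?d a b) +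
      (\<Sum>a\<le>r. \<Sum>b\<le>c. int c * int a * ?d a b)"
    by (simp only: sum.distrib[symmetric] distrib_right[symmetric] diff_add_eq)
  also have "(\<Sum>a\<le>r. \<Sum>b\<le>c. (int r * int b - int r * int c) * ?d a b) =
      (\<Sum>b\<le>c. (int r * int b - int r * int c) * (\<Sum>a\<le>r. ?d a b))"
    by (subst sum.swap) (simp only: sum_distrib_left)
  also have "\<dots> = - (k * int r * int c)"
    unfolding col colk jump by simp
  also have "(\<Sum>a\<le>r. \<Sum>b\<le>c. int c * int a * ?d a b) = (\<Sum>a\<le>r. int c * int a * (\<Sum>b\<le>c. ?d a b))"
    by (simp only: sum_distrib_left)
  also have "\<dots> = 0"
    unfolding row rowk jump by simp
  finally show ?thesis by simp
qed

text \<open>The weight is an affine function of the lattice point \<open>(b, r - a)\<close>, vanishing on the line through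
  \<open>(0, 0)\<close> and \<open>(c, r)\<close>, which contains all turning points.\<close>

definition weight :: "nat list \<Rightarrow> nat \<Rightarrow> nat \<Rightarrow> int" where
  "weight lam a b = int (length lam) * int b + int (part lam 1) * int a -
     int (length lam) * int (part lam 1)"

text \<open>If a neighbour away from the axes is off the diagram, the maximum is \<open>k\<close>
  and the gap vanishes. Otherwise the vertex is an end of the southeast boundary or an outward
  corner, and there the weight vanishes, at corners by balancedness.\<close>

lemma weight_gap_below_eq_0:
  assumes lam: "is_partition lam" "lam \<noteq> []" "balanced lam" and T: "T \<in> SYT lam k"
    and out: "(a + 1, b + 1) \<notin> diagram lam"
    and ab: "a \<le> length lam" "b \<le> part lam 1"
  shows "weight lam a b * gap_below lam k T a b = 0"
proof (cases "(a \<noteq> 0 \<and> (a, b + 1) \<notin> diagram lam) \<or> (b \<noteq> 0 \<and> (a + 1, b) \<notin> diagram lam)")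
  case True
  then have "gap_below lam k T a b = 0"
    using out shifted_bounds(2)[OF lam(1) T, of a "b + 1"] shifted_bounds(2)[OF lam(1) T, of "a + 1" b]
    by (auto simp: gap_below_def shifted_def max_def)
  then show ?thesis by simp
next
  case False
  have len: "0 < length lam" using lam(2) by simp
  have "weight lam a b = 0"
  proof (cases "a = 0")
    case True
    then have "b = part lam 1"
      using False out ab len by (auto simp: diagram_def)
    with True show ?thesis by (simp add: weight_def)
  next
    case a: False
    show ?thesis
    proof (cases "b = 0")
      case True
      have "a = length lam"
      proof (rule ccontr)
        assume "a \<noteq> length lam"
        with ab have "a + 1 \<le> length lam" by simp
        with part_pos[OF lam(1), of "a + 1"] out True show False by (auto simp: diagram_def)
      qed
      with True show ?thesis by (simp add: weight_def)
    next
      case b: False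
      have *: "(a, b + 1) \<in> diagram lam" "(a + 1, b) \<in> diagram lam" using False a b by auto
      then have p: "part lam (a + 1) = b" "b < part lam a" "a + 1 \<le> length lam" "1 \<le> a"
        using out by (auto simp: diagram_def)
      then have "length lam * b = part lam 1 * (length lam - a)"
        using lam(3) unfolding balanced_iff by metis
      then have "int (length lam) * int b = int (part lam 1) * (int (length lam) - int a)"
        using p(3) by (metis of_nat_mult of_nat_diff add_leD1)
      then show ?thesis by (simp add: weight_def algebra_simps)
    qed
  qed
  then show ?thesis by simp
qed

text \<open>On an axis the minimum is 0, attained by the neighbour on that axis; elsewhere all three
  values are \<open>k\<close>. So these terms vanish without help from the weight.\<close>

lemma gap_above_eq_0:
  assumes lam: "is_partition lam" and T: "T \<in> SYT lam k" and out: "(a, b) \<notin> diagram lam"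
  shows "gap_above lam k T a b = 0"
proof (cases "a = 0 \<or> b = 0")
  case True
  then show ?thesis
    using shifted_bounds(1)[OF lam T, of a "b + 1"] shifted_bounds(1)[OF lam T, of "a + 1" b]
    by (auto simp: gap_above_def shifted_def min_def)
next
  case False
  then have "(a, b + 1) \<notin> diagram lam" "(a + 1, b) \<notin> diagram lam"
    using out diagram_left[of a b lam] diagram_up[OF lam, of a b] by auto
  with False out show ?thesis by (simp add: gap_above_def shifted_def)
qed

lemma diagram_subset_box:
  assumes "is_partition lam"
  shows "diagram lam \<subseteq> {1..length lam} \<times> {1..part lam 1}"
  using part_le_first[OF assms] by (force simp: diagram_def)

text \<open>The vanishing terms extend both sums to the whole rectangle of vertices. There
  \<open>max u v + min u v = u + v\<close> turns the difference of the gaps into a mixed second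
  difference.\<close>

lemma sum_weight_gaps:
  assumes lam: "is_partition lam" "lam \<noteq> []" "balanced lam" and T: "T \<in> SYT lam k"
  shows "(\<Sum>(i, j)\<in>diagram lam. weight lam (i - 1) (j - 1) * gap_below lam k T (i - 1) (j - 1)) -
    (\<Sum>(i, j)\<in>diagram lam. weight lam i j * gap_above lam k T i j) =
    - (int k * int (length lam) * int (part lam 1))"
proof -
  let ?r = "length lam" and ?c = "part lam 1"
  let ?h = "shifted lam k T" and ?w = "weight lam"
  have box: "diagram lam \<subseteq> {1..?r} \<times> {1..?c}" by (rule diagram_subset_box[OF lam(1)])
  have below: "(\<Sum>(i, j)\<in>diagram lam. ?w (i - 1) (j - 1) * gap_below lam k T (i - 1) (j - 1)) =
      (\<Sum>(a, b)\<in>{..?r} \<times> {..?c}. ?w a b * gap_below lam k T a b)"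
  proof -
    have "(\<Sum>(i, j)\<in>diagram lam. ?w (i - 1) (j - 1) * gap_below lam k T (i - 1) (j - 1)) =
        (\<Sum>(a, b)\<in>{(a, b). (a + 1, b + 1) \<in> diagram lam}. ?w a b * gap_below lam k T a b)"
      by (rule sum.reindex_bij_witness[of _ "\<lambda>(a, b). (a + 1, b + 1)" "\<lambda>(i, j). (i - 1, j - 1)"])
        (auto simp: diagram_def)
    also have "\<dots> = (\<Sum>(a, b)\<in>{..?r} \<times> {..?c}. ?w a b * gap_below lam k T a b)"
      using box weight_gap_below_eq_0[OF lam T]
      by (intro sum.mono_neutral_left) (force simp: subset_iff)+
    finally show ?thesis .
  qed
  have above: "(\<Sum>(i, j)\<in>diagram lam. ?w i j * gap_above lam k T i j) =
      (\<Sum>(a, b)\<in>{..?r} \<times> {..?c}. ?w a b * gap_above lam k T a b)"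
    using box gap_above_eq_0[OF lam(1) T]
    by (intro sum.mono_neutral_left) (auto simp: subset_iff)
  have "(\<Sum>(a, b)\<in>{..?r} \<times> {..?c}. ?w a b * gap_below lam k T a b) -
      (\<Sum>(a, b)\<in>{..?r} \<times> {..?c}. ?w a b * gap_above lam k T a b) =
      (\<Sum>a\<le>?r. \<Sum>b\<le>?c. ?w a b * (gap_below lam k T a b - gap_above lam k T a b))"
    by (simp add: sum.cartesian_product sum_subtractf right_diff_distrib split_beta)
  also have "\<dots> = (\<Sum>a\<le>?r. \<Sum>b\<le>?c. (int ?r * int b + int ?c * int a - int ?r * int ?c) *
      (?h (a + 1) (b + 1) + ?h a b - ?h a (b + 1) - ?h (a + 1) b))"
    by (intro sum.cong refl arg_cong2[where f = "(*)"])
      (auto simp: weight_def gap_below_def gap_above_def max_def min_def)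
  \<comment> \<open>By \<open>box\<close>, row \<open>?r + 1\<close> and column
    \<open>?c + 1\<close> lie off the diagram, so \<open>shifted\<close> is \<open>k\<close> there
    away from the axes.\<close>
  also have "\<dots> = - (int k * int ?r * int ?c)"
    using box by (intro sum_weighted_mixed_difference) (auto simp: shifted_def)
  finally show ?thesis using below above by simp
qed

theorem theorem3p1:
  fixes k r c :: nat and lam :: "nat list"
  assumes "k > 0"
    and "is_partition lam" and "lam \<noteq> []"
    and "r = length lam" and "c = part lam 1"
    and "balanced lam"
  shows "real (card (BSSYT lam k)) =
    (real k * real r * real c) / (real r + real c) * real (card (SYT lam k))"
proof -
  note lam = assms(2,3,6)
  define p where "p s = int (card {U \<in> BSSYT lam k. card (U s) = 2})" for s
  let ?D = "diagram lam" and ?S = "SYT lam k" and ?w = "weight lam"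
  have p_below: "p (i, j) = (\<Sum>T\<in>?S. gap_below lam k T (i - 1) (j - 1))" if "(i, j) \<in> ?D" for i j
  proof -
    have "i - 1 + 1 = i" "j - 1 + 1 = j" using that by (auto simp: diagram_def)
    then show ?thesis
      using card_double_cell_below[OF lam(1), of "i - 1" "j - 1" k] that by (simp add: p_def)
  qed
  have p_above: "p (i, j) = (\<Sum>T\<in>?S. gap_above lam k T i j)" if "(i, j) \<in> ?D" for i j
    using card_double_cell_above[OF lam(1) that] by (simp add: p_def)
  \<comment> \<open>This is the step of the weight from the bottom-right vertex of a cell to the
    top-left one.\<close>
  have w: "?w (i - 1) (j - 1) = ?w i j - int (r + c)" if "(i, j) \<in> ?D" for i j
    using that assms(4,5) by (auto simp: weight_def diagram_def of_nat_diff algebra_simps)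
  have "- (int k * int r * int c) * int (card ?S) = (\<Sum>T\<in>?S. - (int k * int r * int c))"
    by simp
  also have "\<dots> = (\<Sum>T\<in>?S.
      (\<Sum>(i, j)\<in>?D. ?w (i - 1) (j - 1) * gap_below lam k T (i - 1) (j - 1)) -
      (\<Sum>(i, j)\<in>?D. ?w i j * gap_above lam k T i j))"
    using sum_weight_gaps[OF lam] assms(4,5) by (intro sum.cong) simp_all
  also have "\<dots> = (\<Sum>(i, j)\<in>?D. ?w (i - 1) (j - 1) * (\<Sum>T\<in>?S. gap_below lam k T (i - 1) (j - 1))) -
      (\<Sum>(i, j)\<in>?D. ?w i j * (\<Sum>T\<in>?S. gap_above lam k T i j))"
    unfolding sum_subtractf
    by (subst (1 2) sum.swap) (simp add: sum_distrib_left split_beta)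
  \<comment> \<open>Both inner sums count the same tableaux \<open>p (i, j)\<close>, so only the
    difference of the weights survives.\<close>
  also have "\<dots> = (\<Sum>(i, j)\<in>?D. ?w (i - 1) (j - 1) * p (i, j)) - (\<Sum>(i, j)\<in>?D. ?w i j * p (i, j))"
    using p_below p_above
    by (intro arg_cong2[where f = "(-)"] sum.cong) auto
  also have "\<dots> = (\<Sum>(i, j)\<in>?D. - int (r + c) * p (i, j))"
    unfolding sum_subtractf[symmetric]
    by (intro sum.cong refl) (auto simp: w[unfolded One_nat_def] left_diff_distrib simp del: of_nat_add)
  also have "\<dots> = - int (r + c) * (\<Sum>s\<in>?D. p s)"
    unfolding sum_distrib_left by (intro sum.cong) auto
  also have "(\<Sum>s\<in>?D. p s) = int (card (BSSYT lam k))"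
    by (simp add: card_BSSYT_eq_sum p_def)
  finally have "int (k * r * c * card ?S) = int ((r + c) * card (BSSYT lam k))"
    by (simp add: algebra_simps)
  then have "real (k * r * c * card ?S) = real ((r + c) * card (BSSYT lam k))"
    by (simp only: of_nat_eq_iff)
  moreover have "real r + real c > 0" using assms(3,4) by (cases lam) auto
  ultimately show ?thesis by (simp add: field_simps)
qed

end
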